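(* For any $\Delta>0$ and $w,z\in\mathbb{C}$, \[ K_{\mathrm{O},\pi\Delta}(w,z) = \frac{\sin\pi\Delta(z-\overline{w})}{\pi(z-\overline{w})} - \frac{1}{2 + \Delta} \left(\frac{\sin\pi\Delta z}{\pi z}\right) \left( \frac{\sin\pi\Delta \overline{w} }{\pi \overline{w}}\right). \]
   Context: $W_{\mathrm O}(x)=1+\frac12\boldsymbol{\delta}_0(x)$, with $\boldsymbol{\delta}_0$ the Dirac delta at $0$. For $\Delta>0$, $\mathcal{H}_{\mathrm O,\pi\Delta}$ is the Hilbert space of entire functions $F$ of exponential type at most $\pi\Delta$ with $\int_{\mathbb{R}}|F(x)|^2dx+\frac12|F(0)|^2<\infty$, with inner product $\langle F,H\rangle=\int_{\mathbb{R}}F(x)\overline{H(x)}\,dx+\frac12F(0)\overline{H(0)}$. Its reproducing kernel $K_{\mathrm O,\pi\Delta}$ is the unique function on $\mathbb{C}\times\mathbb{C}$ such that for each $w$, $K_{\mathrm O,\pi\Delta}(w,\cdot)\in\mathcal{H}_{\mathrm O,\pi\Delta}$ and $F(w)=\langle F,K_{\mathrm O,\pi\Delta}(w,\cdot)\rangle$ for all $F$ in the space. Expressions like $\frac{\sin \pi\Delta z}{\pi z}$ are interpreted by continuity ($=\Delta$) at $z=0$. *)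

theory Defs
  imports "HOL-Analysis.Analysis"
begin

definition exp_type_le :: "real \<Rightarrow> (complex \<Rightarrow> complex) \<Rightarrow> bool" where
  "exp_type_le tau F \<longleftrightarrow>
     (\<forall>\<epsilon>>0. \<exists>C. \<forall>z. norm (F z) \<le> C * exp ((tau + \<epsilon>) * norm z))"

text \<open>The space H_{O, pi Delta}: entire functions of exponential type at most pi Delta
  with finite norm (the point mass term 1/2 |F(0)|^2 is always finite).\<close>
definition HO :: "real \<Rightarrow> (complex \<Rightarrow> complex) set" where
  "HO Delta = {F. F holomorphic_on UNIV \<and> exp_type_le (pi * Delta) F \<and>
                  integrable lborel (\<lambda>x::real. (norm (F (complex_of_real x)))\<^sup>2)}"

text \<open>Inner product with respect to the measure 1 + (1/2) delta_0.\<close>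
definition HO_inner :: "(complex \<Rightarrow> complex) \<Rightarrow> (complex \<Rightarrow> complex) \<Rightarrow> complex" where
  "HO_inner F H = (LINT x|lborel. F (complex_of_real x) * cnj (H (complex_of_real x)))
                  + 1/2 * F 0 * cnj (H 0)"

definition KO :: "real \<Rightarrow> complex \<Rightarrow> complex \<Rightarrow> complex" where
  "KO Delta = (THE K. (\<forall>w. K w \<in> HO Delta) \<and>
                      (\<forall>w. \<forall>F\<in>HO Delta. F w = HO_inner F (K w)))"

text \<open>sin(pi Delta z)/(pi z), extended by continuity (value Delta) at z = 0.\<close>
definition sincD :: "real \<Rightarrow> complex \<Rightarrow> complex" where
  "sincD Delta z = (if z = 0 then complex_of_real Delta
                    else sin (complex_of_real (pi * Delta) * z) / (complex_of_real pi * z))"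

end

theory Submission
  imports Defs
    "HOL-Complex_Analysis.Complex_Analysis"
    "HOL-Probability.Sinc_Integral"
    "HOL-Real_Asymp.Real_Asymp"
begin

text \<open>
  The Paley--Wiener space (no point mass) has kernel $\sin \pi\Delta(z-\bar w)/\pi(z-\bar w)$; a
  rank-one correction then absorbs the mass at $0$. The Paley--Wiener formula comes directly from
  the growth definition. For $F$ of exponential type, multiplication by a factor
  $\sin(\pi\eta(z-w))/\pi\eta(z-w)$ makes $F$ integrable on the real line, so that its primitive is
  bounded there; Phragmen--Lindelof in each quadrant and Cauchy's inequality turn this into
  $|F(z)| \le M e^{\sigma|\Im z|}$. A second such factor adds decay, so that splitting the sine into
  exponentials and closing the contour in the upper and lower half planes yields the value at $w$.
  Finally $\eta \to 0$ by dominated convergence.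
\<close>

text \<open>Membership in \<open>HO\<close> gives no pointwise control on the real line:
  \<open>F\<close> is only square integrable there, and its growth is known only up to an arbitrary
  positive excess of the type. A product of two square integrable functions is integrable, and an
  integral bounds the increments of a primitive; this is why a regularizing factor precedes any use
  of Phragmen-Lindelof. Each step costs a little type, which is harmless because a kernel of larger
  type still reproduces functions of smaller type. The shape of the correction is natural: the point
  mass changes the pairing only by a multiple of \<open>F 0\<close>, and evaluation at 0 is
  represented by the Paley-Wiener kernel at 0. The denominator \<open>2 + Delta\<close> combines the
  weight 1/2 of the mass with the value \<open>Delta\<close> of that kernel at the origin.\<close>

subsection \<open>Entire functions of exponential type\<close>

text \<open>
  The map $z \mapsto (1-i)z+1$ sends the closed first quadrant into the sector
  $|\arg u| \le \pi/4$, on which $\Re u^{3/2}$ grows like $|u|^{3/2}$.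
\<close>

lemma quadrant_multiplier:
  assumes "Re z \<ge> 0" "Im z \<ge> 0"
  shows "z * (1 - \<i>) + 1 \<notin> \<real>\<^sub>\<le>\<^sub>0"
    and "Re (csqrt (z * (1 - \<i>) + 1) ^ 3) \<ge> norm z * sqrt (norm z) / 4"
proof -
  define u where "u = z * (1 - \<i>) + 1"
  define a b where "a = Re (csqrt u)" and "b = Im (csqrt u)"
  have Re_u: "Re u = Re z + Im z + 1" and Im_u: "Im u = Im z - Re z"
    by (simp_all add: u_def)
  \<comment> \<open>The summand 1 keeps \<open>u\<close> off the branch point 0 when
    \<open>z = 0\<close>; it also makes the inequality |Im u| < Re u below strict.\<close>
  show "z * (1 - \<i>) + 1 \<notin> \<real>\<^sub>\<le>\<^sub>0"
    using assms by (simp add: complex_nonpos_Reals_iff)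
  have a: "a \<ge> 0" using csqrt_principal[of u] unfolding a_def by linarith
  have v: "csqrt u = Complex a b" unfolding a_def b_def by (rule complex_surj[symmetric])
  have "(csqrt u)\<^sup>2 = u" by simp
  then have "Re ((csqrt u)\<^sup>2) = Re u" "Im ((csqrt u)\<^sup>2) = Im u" by simp_all
  then have re: "a\<^sup>2 - b\<^sup>2 = Re z + Im z + 1" and im: "2 * a * b = Im z - Re z"
    unfolding v by (simp_all add: Re_u Im_u power2_eq_square)
  have "2 * a * \<bar>b\<bar> = \<bar>2 * a * b\<bar>" using a by (simp add: abs_mult)
  also have "\<dots> < a\<^sup>2 - b\<^sup>2" unfolding im re using assms by auto
  finally have 1: "2 * a * \<bar>b\<bar> < a\<^sup>2 - b\<^sup>2" .
  \<comment> \<open>Halving the angle \<pi>/4 gives |b| / a at most tan (\<pi>/8) = sqrt 2 - 1 <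
    1/2. The cruder 1/2 already yields a^2 - 3 b^2 \<ge> a^2 / 4, the source of the constant
    1/4.\<close>
  have "2 * \<bar>b\<bar> \<le> a"
  proof (rule ccontr)
    assume "\<not> 2 * \<bar>b\<bar> \<le> a"
    then have "a * a \<le> a * (2 * \<bar>b\<bar>)" using a by (intro mult_left_mono) auto
    then show False using 1 zero_le_square[of b] unfolding power2_eq_square by linarith
  qed
  then have "(2 * \<bar>b\<bar>)\<^sup>2 \<le> a\<^sup>2" by (intro power_mono) auto
  then have 4: "4 * b\<^sup>2 \<le> a\<^sup>2" by (simp add: power_mult_distrib)
  have nz: "norm z \<le> a\<^sup>2"
    using cmod_le[of z] assms re zero_le_power2[of b] by linarith
  then have "sqrt (norm z) \<le> a"
    using a by (intro real_le_lsqrt) auto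
  then have "norm z * sqrt (norm z) \<le> a\<^sup>2 * a"
    using nz a by (intro mult_mono) auto
  also have "\<dots> \<le> 4 * (a * (a\<^sup>2 - 3 * b\<^sup>2))"
    using mult_left_mono[OF 4 a] by (simp add: algebra_simps)
  also have "a * (a\<^sup>2 - 3 * b\<^sup>2) = Re (csqrt u ^ 3)"
    unfolding v by (simp add: power3_eq_cube power2_eq_square algebra_simps)
  finally show "Re (csqrt (z * (1 - \<i>) + 1) ^ 3) \<ge> norm z * sqrt (norm z) / 4"
    by (simp add: u_def)
qed

text \<open>The critical order for a right angle is 2. The growth of \<open>f\<close> has order 1,
  so damping by exp (- e v) with \<open>v\<close> of order 3/2 beats it on large arcs, while the
  damping factor has modulus at most 1 on the two bounding rays. The maximum principle on a quarter
  disc gives M exp (e Re v), and \<open>e\<close> tends to 0.\<close>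

theorem Phragmen_Lindelof_quadrant:
  assumes hol: "f holomorphic_on UNIV"
    and growth: "\<And>z. norm (f z) \<le> B * exp (A * norm z)"
    and re: "\<And>x. x \<ge> 0 \<Longrightarrow> norm (f (of_real x)) \<le> M"
    and im: "\<And>y. y \<ge> 0 \<Longrightarrow> norm (f (\<i> * of_real y)) \<le> M"
    and M: "M > 0" and z: "Re z \<ge> 0" "Im z \<ge> 0"
  shows "norm (f z) \<le> M"
proof -
  define v where "v = (\<lambda>z. csqrt (z * (1 - \<i>) + 1) ^ 3)"
  have v_ge: "Re (v z) \<ge> norm z * sqrt (norm z) / 4" if "Re z \<ge> 0" "Im z \<ge> 0" for z
    using quadrant_multiplier(2)[OF that] by (simp add: v_def)
  have v_ge0: "Re (v z) \<ge> 0" if "Re z \<ge> 0" "Im z \<ge> 0" for z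
    using v_ge[OF that] by (rule order_trans[rotated]) simp
  have B: "B \<ge> 0"
    using order_trans[OF norm_ge_zero growth[of 0]] by simp
  have main: "norm (f z) \<le> M * exp (e * Re (v z))" if e: "e > 0" for e
  proof -
    define g where "g = (\<lambda>z. f z * exp (- of_real e * v z))"
    have norm_g: "norm (g z) = norm (f z) * exp (- e * Re (v z))" for z
      by (simp add: g_def norm_mult)
    \<comment> \<open>On the arc of radius \<open>R\<close> the damping exponent is at least e R
      sqrt R / 4 \<ge> (A + 1) R, so of the growth B exp (A R) at most B exp (- R) remains.\<close>
    have ev1: "eventually (\<lambda>R. e / 4 * sqrt R \<ge> A + 1) at_top"
      using e by real_asymp
    have "((\<lambda>R. B * exp (- R)) \<longlongrightarrow> 0) at_top" by real_asymp
    then have ev2: "eventually (\<lambda>R. B * exp (- R) < M) at_top"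
      using M by (rule order_tendstoD)
    have "eventually (\<lambda>R. e / 4 * sqrt R \<ge> A + 1 \<and> B * exp (- R) < M \<and> R > norm z) at_top"
      using ev1 ev2 eventually_gt_at_top by (intro eventually_conj) auto
    then obtain R where R: "e / 4 * sqrt R \<ge> A + 1" "B * exp (- R) < M" "R > norm z"
      by (auto dest: eventually_happens)
    define S where "S = {z. Re z \<ge> 0} \<inter> {z. Im z \<ge> 0} \<inter> cball 0 R"
    have "closed S" unfolding S_def
      by (intro closed_Int closed_halfspace_Re_ge closed_halfspace_Im_ge closed_cball)
    have holS: "g holomorphic_on S" unfolding g_def v_def
      using quadrant_multiplier(1)
      by (intro holomorphic_intros holomorphic_on_subset[OF hol]) (auto simp: S_def)
    have "norm (g z) \<le> M"
    proof (rule maximum_modulus_frontier[where f = g])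
      show "g holomorphic_on interior S"
        using holS interior_subset holomorphic_on_subset by blast
      show "continuous_on (closure S) g"
        using holS \<open>closed S\<close> by (simp add: holomorphic_on_imp_continuous_on)
      show "bounded S" unfolding S_def by (meson Int_lower2 bounded_cball bounded_subset)
      show "z \<in> S" using z R by (auto simp: S_def)
    next
      fix x assume x: "x \<in> frontier S"
      then have xS: "x \<in> S" using \<open>closed S\<close> by (metis frontier_subset_closed subsetD)
      then have x0: "Re x \<ge> 0" "Im x \<ge> 0" "norm x \<le> R" by (auto simp: S_def)
      \<comment> \<open>The open set \<open>T\<close> lies inside \<open>S\<close>, so a frontier
        point must violate one of its three strict inequalities.\<close>
      define T where "T = {z. Re z > 0} \<inter> {z. Im z > 0} \<inter> ball 0 R"
      have "open T" unfolding T_def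
        by (intro open_Int open_halfspace_Re_gt open_halfspace_Im_gt open_ball)
      moreover have "T \<subseteq> S" by (auto simp: T_def S_def)
      ultimately have "x \<notin> T" using x by (auto simp: frontier_def interior_def)
      then consider "Re x = 0" | "Im x = 0" | "norm x = R"
        using x0 by (auto simp: T_def)
      then show "norm (g x) \<le> M"
      proof cases
        case 1
        then have "x = \<i> * of_real (Im x)" by (simp add: complex_eq_iff)
        then have "norm (f x) \<le> M" using im[of "Im x"] x0 by metis
        moreover have "exp (- e * Re (v x)) \<le> 1" using v_ge0[OF x0(1,2)] e by simp
        ultimately show ?thesis unfolding norm_g using M
          by (metis mult.right_neutral mult_mono norm_ge_zero exp_ge_zero order_less_imp_le)
      next
        case 2
        then have "x = of_real (Re x)" by (simp add: complex_eq_iff)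
        then have "norm (f x) \<le> M" using re[of "Re x"] x0 by metis
        moreover have "exp (- e * Re (v x)) \<le> 1" using v_ge0[OF x0(1,2)] e by simp
        ultimately show ?thesis unfolding norm_g using M
          by (metis mult.right_neutral mult_mono norm_ge_zero exp_ge_zero order_less_imp_le)
      next
        case 3
        have "R * (A + 1) \<le> R * (e / 4 * sqrt R)"
          using R(1) 3 by (intro mult_left_mono) auto
        also have "\<dots> \<le> e * Re (v x)"
          using mult_left_mono[OF v_ge[OF x0(1,2)], of e] e by (simp add: 3 mult_ac)
        finally have *: "A * R - e * Re (v x) \<le> - R" by (simp add: algebra_simps)
        have "norm (g x) \<le> B * exp (A * R) * exp (- e * Re (v x))"
          unfolding norm_g using growth[of x] 3 by (intro mult_right_mono) auto
        also have "\<dots> = B * exp (A * R - e * Re (v x))" by (simp add: exp_add[symmetric])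
        also have "\<dots> \<le> B * exp (- R)" using B * by (intro mult_left_mono) auto
        finally show ?thesis using R(2) by simp
      qed
    qed
    then show ?thesis unfolding norm_g by (simp add: exp_minus field_simps)
  qed
  have "((\<lambda>e. M * exp (e * Re (v z))) \<longlongrightarrow> M * exp (0 * Re (v z))) (at_right 0)"
    by (intro tendsto_intros)
  moreover have "eventually (\<lambda>e. norm (f z) \<le> M * exp (e * Re (v z))) (at_right 0)"
    using main by (auto simp: eventually_at_right_field intro: exI[of _ 1])
  ultimately show ?thesis
    using tendsto_lowerbound[of _ _ "at_right (0::real)" "norm (f z)"] by simp
qed

text \<open>The factor exp (i s z) has modulus exp (- s Im z): it is 1 on the real axis and cancels
  the growth exactly on the positive imaginary axis. The product is bounded by \<open>M\<close> on
  one ray and by \<open>C\<close> on the other, so Phragmen-Lindelof applies to it.\<close>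

lemma exp_growth_quadrant_bound:
  assumes hol: "P holomorphic_on UNIV"
    and growth: "\<And>z. norm (P z) \<le> C * exp (s * norm z)"
    and real_bd: "\<And>x. norm (P (of_real x)) \<le> M"
    and z: "Re z \<ge> 0" "Im z \<ge> 0"
  shows "norm (P z) \<le> (M + C + 1) * exp (s * Im z)"
proof -
  define f where "f = (\<lambda>z. P z * exp (\<i> * of_real s * z))"
  have norm_f: "norm (f z) = norm (P z) * exp (- s * Im z)" for z
    by (simp add: f_def norm_mult)
  have C: "C \<ge> 0"
    using order_trans[OF norm_ge_zero growth[of 0]] by simp
  have M: "M \<ge> 0"
    using order_trans[OF norm_ge_zero real_bd[of 0]] by simp
  have "norm (f z) \<le> M + C + 1"
  \<comment> \<open>The growth condition is over the whole plane and for either sign of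
    \<open>s\<close>, where the factor can reach exp (|s| |z|). The extra 1 in the bound makes it
    positive.\<close>
  proof (rule Phragmen_Lindelof_quadrant[where f = f and B = C and A = "s + \<bar>s\<bar>"])
    show "f holomorphic_on UNIV" unfolding f_def by (intro holomorphic_intros hol)
    show "norm (f z) \<le> C * exp ((s + \<bar>s\<bar>) * norm z)" for z
    proof -
      have "- s * Im z \<le> \<bar>s * Im z\<bar>" by simp
      also have "\<dots> \<le> \<bar>s\<bar> * norm z"
        unfolding abs_mult by (intro mult_left_mono abs_Im_le_cmod) auto
      finally have "norm (f z) \<le> C * exp (s * norm z) * exp (\<bar>s\<bar> * norm z)"
        unfolding norm_f using growth C by (intro mult_mono) auto
      then show ?thesis by (simp add: exp_add[symmetric] algebra_simps)
    qed
    show "norm (f (of_real x)) \<le> M + C + 1" for x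
      using real_bd[of x] C by (simp add: norm_f)
    show "norm (f (\<i> * of_real y)) \<le> M + C + 1" if "y \<ge> 0" for y
    proof -
      have "norm (f (\<i> * of_real y)) \<le> C * exp (s * y) * exp (- s * y)"
        unfolding norm_f using growth[of "\<i> * of_real y"] that C by (intro mult_mono) (auto simp: norm_mult)
      also have "\<dots> = C" by (simp add: exp_minus)
      finally show ?thesis using M by simp
    qed
  qed (use z M C in auto)
  then show ?thesis unfolding norm_f by (simp add: exp_minus field_simps)
qed

lemma holomorphic_cnj_conjugate:
  assumes "f holomorphic_on UNIV"
  shows "(\<lambda>z. cnj (f (cnj z))) holomorphic_on UNIV"
proof -
  have "(cnj \<circ> f \<circ> cnj) holomorphic_on UNIV"
    using assms surjI[of cnj cnj] by (intro holomorphic_on_compose_cnj_cnj) auto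
  then show ?thesis by (simp add: o_def)
qed

text \<open>The reflections z \<mapsto> - cnj z and z \<mapsto> cnj z carry the other quadrants to
  the first. Conjugating the values as well keeps the function entire, and both bounds survive. The
  half plane case is stated for an arbitrary \<open>Q\<close> because the function reflected in the
  real axis uses it too.\<close>

lemma exp_growth_bound:
  assumes hol: "P holomorphic_on UNIV"
    and growth: "\<And>z. norm (P z) \<le> C * exp (s * norm z)"
    and real_bd: "\<And>x. norm (P (of_real x)) \<le> M"
  shows "norm (P z) \<le> (M + C + 1) * exp (s * \<bar>Im z\<bar>)"
proof -
  have upper: "norm (Q z) \<le> (M + C + 1) * exp (s * \<bar>Im z\<bar>)"
    if hol: "Q holomorphic_on UNIV"
    and growth: "\<And>z. norm (Q z) \<le> C * exp (s * norm z)"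
    and real_bd: "\<And>x. norm (Q (of_real x)) \<le> M" and Im: "Im z \<ge> 0" for Q z
  proof (cases "Re z \<ge> 0")
    case True
    then show ?thesis using exp_growth_quadrant_bound[OF that(1-3), of z] Im by simp
  next
    case False
    have "norm (cnj (Q (- cnj (- cnj z)))) \<le> (M + C + 1) * exp (s * Im (- cnj z))"
    proof (rule exp_growth_quadrant_bound[where P = "\<lambda>z. cnj (Q (- cnj z))"])
      have "(\<lambda>z. Q (- z)) holomorphic_on UNIV"
        using holomorphic_on_compose_gen[of "\<lambda>z. - z" UNIV Q UNIV] hol
        by (simp add: o_def holomorphic_on_minus)
      from holomorphic_cnj_conjugate[OF this]
      show "(\<lambda>z. cnj (Q (- cnj z))) holomorphic_on UNIV" .
      show "norm (cnj (Q (- cnj z))) \<le> C * exp (s * norm z)" for z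
        using growth[of "- cnj z"] by simp
      show "norm (cnj (Q (- cnj (of_real x)))) \<le> M" for x
        using real_bd[of "-x"] by simp
    qed (use False Im in auto)
    then show ?thesis using Im by simp
  qed
  show ?thesis
  proof (cases "Im z \<ge> 0")
    case True
    then show ?thesis using upper[OF assms] by simp
  next
    case False
    have "norm (cnj (P (cnj (cnj z)))) \<le> (M + C + 1) * exp (s * \<bar>Im (cnj z)\<bar>)"
    proof (rule upper[where Q = "\<lambda>z. cnj (P (cnj z))"])
      show "(\<lambda>z. cnj (P (cnj z))) holomorphic_on UNIV"
        by (rule holomorphic_cnj_conjugate[OF hol])
      show "norm (cnj (P (cnj z))) \<le> C * exp (s * norm z)" for z
        using growth[of "cnj z"] by simp
      show "norm (cnj (P (cnj (of_real x)))) \<le> M" for x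
        using real_bd[of x] by simp
    qed (use False in auto)
    then show ?thesis by simp
  qed
qed

section \<open>Primitives and growth of functions integrable on the real line\<close>

lemma entire_primitive:
  assumes "F holomorphic_on UNIV"
  obtains P where "\<And>z. (P has_field_derivative F z) (at z)" "P 0 = 0"
proof -
  obtain g where g: "\<And>z. (g has_field_derivative F z) (at z)"
    using holomorphic_convex_primitive'[of UNIV F] assms by auto
  have "((\<lambda>z. g z - g 0) has_field_derivative F z) (at z)" for z
    using g by (auto intro!: derivative_eq_intros)
  then show ?thesis using that by fastforce
qed

lemma primitive_has_integral_real:
  fixes P :: "complex \<Rightarrow> complex"
  assumes "\<And>z. (P has_field_derivative F z) (at z)" "a \<le> b"
  shows "((\<lambda>x. F (of_real x)) has_integral (P (of_real b) - P (of_real a))) {a..b}"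
proof (rule fundamental_theorem_of_calculus[OF assms(2)])
  fix x assume "x \<in> {a..b}"
  have "((P \<circ> of_real) has_vector_derivative 1 * F (of_real x)) (at x within {a..b})"
    by (intro field_vector_diff_chain_within)
       (auto intro!: derivative_eq_intros has_field_derivative_at_within[OF assms(1)]
          simp: has_vector_derivative_of_real)
  then show "((\<lambda>x. P (of_real x)) has_vector_derivative F (of_real x)) (at x within {a..b})"
    by (simp add: o_def)
qed

lemma exp_type_integrable_bound:
  assumes hol: "F holomorphic_on UNIV" and type: "exp_type_le \<tau> F"
    and int: "integrable lborel (\<lambda>x. F (complex_of_real x))"
    and \<tau>: "0 \<le> \<tau>" "\<tau> < \<sigma>"
  obtains M where "M > 0" "\<And>z. norm (F z) \<le> M * exp (\<sigma> * \<bar>Im z\<bar>)"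
proof -
  obtain P where P: "\<And>z. (P has_field_derivative F z) (at z)" and P0: "P 0 = 0"
    using entire_primitive[OF hol] by metis
  \<comment> \<open>One half of the gap between \<open>\<tau>\<close> and \<open>\<sigma>\<close> is
    the excess allowed by the definition of type; the other half absorbs the factor
    \<open>norm z\<close> that the primitive gains, through e |z| \<le> exp (e |z|).\<close>
  define e where "e = (\<sigma> - \<tau>) / 2"
  have e: "e > 0" using \<tau> by (simp add: e_def)
  then obtain C where C: "\<And>z. norm (F z) \<le> C * exp ((\<tau> + e) * norm z)"
    using type unfolding exp_type_le_def by blast
  have C0: "C \<ge> 0"
    using order_trans[OF norm_ge_zero C[of 0]] by simp
  have growth: "norm (P z) \<le> (C / e) * exp (\<sigma> * norm z)" for z
  proof -
    have "norm (P z - P 0) \<le> C * exp ((\<tau> + e) * norm z) * norm (z - 0)"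
    proof (rule field_differentiable_bound[of "cball 0 (norm z)"])
      fix y :: complex assume "y \<in> cball 0 (norm z)"
      then have "C * exp ((\<tau> + e) * norm y) \<le> C * exp ((\<tau> + e) * norm z)"
        using C0 \<tau> e by (intro mult_left_mono) (auto intro!: mult_left_mono)
      then show "norm (F y) \<le> C * exp ((\<tau> + e) * norm z)" using C[of y] by simp
    qed (auto intro: has_field_derivative_at_within[OF P])
    also have "\<dots> = (C / e) * exp ((\<tau> + e) * norm z) * (e * norm z)" using e by simp
    also have "\<dots> \<le> (C / e) * exp ((\<tau> + e) * norm z) * exp (e * norm z)"
    proof (rule mult_left_mono)
      show "e * norm z \<le> exp (e * norm z)" using exp_ge_add_one_self[of "e * norm z"] by linarith
    qed (use C0 e in auto)
    also have "\<dots> = (C / e) * exp (\<sigma> * norm z)"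
      by (simp add: exp_add[symmetric] e_def field_simps)
    finally show ?thesis by (simp add: P0)
  qed
  define N where "N = integral UNIV (\<lambda>x. norm (F (complex_of_real x)))"
  have intN: "(\<lambda>x. norm (F (complex_of_real x))) integrable_on UNIV"
    by (rule integrable_on_lborel[OF integrable_norm[OF int]])
  have seg: "norm (P (of_real b) - P (of_real a)) \<le> N" if "a \<le> b" for a b
  proof -
    note h = primitive_has_integral_real[OF P that]
    have i: "(\<lambda>x. norm (F (complex_of_real x))) integrable_on {a..b}"
      using integrable_on_subinterval[OF intN, of a b] by simp
    have "norm (integral {a..b} (\<lambda>x. F (complex_of_real x)))
        \<le> integral {a..b} (\<lambda>x. norm (F (complex_of_real x)))"
      using h i by (intro integral_norm_bound_integral) auto
    also have "\<dots> \<le> N" unfolding N_def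
      by (intro integral_subset_le i intN) auto
    finally show ?thesis using h by (simp add: integral_unique)
  qed
  have real_bd: "norm (P (of_real x)) \<le> N" for x :: real
    using seg[of 0 x] seg[of x 0] by (cases "x \<ge> 0") (auto simp: P0)
  have N0: "N \<ge> 0" using order_trans[OF norm_ge_zero real_bd[of 0]] .
  have holP: "P holomorphic_on UNIV" using P by (auto simp: holomorphic_on_open)
  define K where "K = N + C / e + 1"
  have K: "K > 0" using N0 C0 e by (simp add: K_def add_nonneg_pos)
  have bdP: "norm (P z) \<le> K * exp (\<sigma> * \<bar>Im z\<bar>)" for z
    unfolding K_def by (rule exp_growth_bound[OF holP growth real_bd])
  have "norm (F z) \<le> K * exp \<sigma> * exp (\<sigma> * \<bar>Im z\<bar>)" for z
  proof -
    \<comment> \<open>On the unit circle about \<open>z\<close> the value of |Im| grows by at most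
      1, so the bound for \<open>P\<close> passes to its derivative with the loss of a factor exp
      \<sigma>, uniformly in \<open>z\<close>.\<close>
    have "norm ((deriv ^^ 1) P z) \<le> fact 1 * (K * exp \<sigma> * exp (\<sigma> * \<bar>Im z\<bar>)) / 1 ^ 1"
    proof (rule Cauchy_inequality[where f = P])
      show "P holomorphic_on ball z 1" "continuous_on (cball z 1) P"
        using holP holomorphic_on_subset holomorphic_on_imp_continuous_on by (blast, metis subset_UNIV)
      fix x assume "norm (z - x) = 1"
      then have "\<bar>Im (z - x)\<bar> \<le> 1" by (metis abs_Im_le_cmod)
      then have "\<bar>Im x\<bar> \<le> 1 + \<bar>Im z\<bar>" by simp
      then have "\<sigma> * \<bar>Im x\<bar> \<le> \<sigma> * (1 + \<bar>Im z\<bar>)" using \<tau> by (intro mult_left_mono) auto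
      then have "K * exp (\<sigma> * \<bar>Im x\<bar>) \<le> K * (exp \<sigma> * exp (\<sigma> * \<bar>Im z\<bar>))"
        using K by (auto simp: exp_add[symmetric] algebra_simps)
      then show "norm (P x) \<le> K * exp \<sigma> * exp (\<sigma> * \<bar>Im z\<bar>)"
        using bdP[of x] by simp
    qed auto
    then show ?thesis using DERIV_imp_deriv[OF P] by simp
  qed
  then show ?thesis using that[of "K * exp \<sigma>"] K by simp
qed

subsection \<open>The cardinal sine\<close>

text \<open>The factor \<open>norm v\<close>, absent from the plain exponential bound, cancels the
  denominator of \<open>sincD\<close> near 0. It comes from the mean value inequality on the segment
  from 0 to \<open>v\<close>.\<close>

lemma norm_sin_le:
  fixes v :: complex
  shows "norm (sin v) \<le> norm v * exp \<bar>Im v\<bar>"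
proof -
  have "norm (sin v - sin 0) \<le> exp \<bar>Im v\<bar> * norm (v - 0)"
  proof (rule field_differentiable_bound[of "closed_segment 0 v"])
    fix z assume "z \<in> closed_segment 0 v"
    then obtain u where "0 \<le> u" "u \<le> 1" "z = u *\<^sub>R v" by (auto simp: in_segment)
    then show "norm (cos z) \<le> exp \<bar>Im v\<bar>" using cmod_cos_le_exp by metis
  qed (auto intro!: derivative_eq_intros)
  then show ?thesis by (simp add: mult.commute)
qed

lemma norm_sincD_le:
  assumes "D \<ge> 0"
  shows "norm (sincD D z) \<le> D * exp (pi * D * \<bar>Im z\<bar>)"
proof (cases "z = 0")
  case False
  have "norm (sin (complex_of_real (pi * D) * z)) \<le> pi * D * norm z * exp (pi * D * \<bar>Im z\<bar>)"
    using norm_sin_le[of "complex_of_real (pi * D) * z"] assms by (simp add: norm_mult abs_mult)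
  then show ?thesis using False by (simp add: sincD_def norm_divide norm_mult field_simps)
qed (use assms in \<open>simp add: sincD_def\<close>)

lemma norm_mult_sincD_le:
  assumes "D \<ge> 0"
  shows "norm z * norm (sincD D z) \<le> exp (pi * D * \<bar>Im z\<bar>)"
proof (cases "z = 0")
  case False
  have "norm (sin (complex_of_real (pi * D) * z)) \<le> exp (pi * D * \<bar>Im z\<bar>)"
    using cmod_sin_le_exp[of 1 "complex_of_real (pi * D) * z"] assms by (simp add: abs_mult)
  also have "\<dots> \<le> pi * exp (pi * D * \<bar>Im z\<bar>)"
    using pi_ge_two by simp
  finally show ?thesis using False by (simp add: sincD_def norm_divide norm_mult field_simps)
qed simp

text \<open>The bounds near 0 and far away are added, so that a single inequality gives square
  integrability along horizontal lines.\<close>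

lemma norm_sincD_decay:
  assumes "D \<ge> 0"
  shows "norm (sincD D z) \<le> (D + 1) * exp (pi * D * \<bar>Im z\<bar>) / (1 + norm z)"
proof -
  have "(1 + norm z) * norm (sincD D z) \<le> (D + 1) * exp (pi * D * \<bar>Im z\<bar>)"
    using norm_sincD_le[OF assms, of z] norm_mult_sincD_le[OF assms, of z] by (simp add: algebra_simps)
  then show ?thesis by (simp add: field_simps add_pos_nonneg)
qed

lemma holomorphic_difference_quotient:
  assumes "f holomorphic_on UNIV"
  shows "(\<lambda>z. if z = a then deriv f a else (f z - f a) / (z - a)) holomorphic_on UNIV"
  using pole_lemma[of f UNIV a] assms by simp

lemma holomorphic_sincD: "sincD D holomorphic_on UNIV"
proof -
  define f where "f = (\<lambda>z. sin (complex_of_real (pi * D) * z) / complex_of_real pi)"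
  have "f holomorphic_on UNIV" unfolding f_def by (intro holomorphic_intros) auto
  from holomorphic_difference_quotient[OF this, of 0]
  have "(\<lambda>z. if z = 0 then deriv f 0 else (f z - f 0) / (z - 0)) holomorphic_on UNIV" .
  moreover have "(f has_field_derivative of_real D) (at 0)"
    unfolding f_def by (auto intro!: derivative_eq_intros)
  then have "deriv f 0 = of_real D" by (rule DERIV_imp_deriv)
  ultimately show ?thesis by (simp add: f_def sincD_def[abs_def] cong: if_cong)
qed

lemma holomorphic_sincD' [holomorphic_intros]:
  assumes "f holomorphic_on UNIV"
  shows "(\<lambda>z. sincD D (f z)) holomorphic_on UNIV"
  using holomorphic_on_compose_gen[OF assms holomorphic_sincD] by (simp add: o_def)

lemma continuous_on_entire_real:
  assumes "f holomorphic_on UNIV"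
  shows "continuous_on UNIV (\<lambda>x. f (complex_of_real x))"
  by (intro continuous_on_compose2[OF holomorphic_on_imp_continuous_on[OF assms]] continuous_intros) auto

lemma borel_measurable_entire_real:
  assumes "f holomorphic_on UNIV"
  shows "(\<lambda>x. f (complex_of_real x)) \<in> borel_measurable lborel"
  using borel_measurable_continuous_onI[OF continuous_on_entire_real[OF assms]] by simp

subsection \<open>The Paley--Wiener reproducing formula\<close>

text \<open>Supplies the only term of the next contour argument that survives as the radius
  grows.\<close>

lemma has_contour_integral_inverse_half_circle:
  assumes "R > 0"
  shows "((\<lambda>z. c / z) has_contour_integral (\<i> * pi * c)) (part_circlepath 0 R 0 pi)"
proof -
  have "((\<lambda>t. \<i> * c) has_integral (pi - 0) *\<^sub>R (\<i> * c)) {0..pi}"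
    by (rule has_integral_const_real[THEN has_integral_eq_rhs]) simp
  moreover have "(\<lambda>t. c / (0 + of_real R * cis t) * of_real R * \<i> * cis t) = (\<lambda>t. \<i> * c)"
    using assms by (auto simp: field_simps)
  ultimately show ?thesis
    by (subst has_contour_integral_part_circlepath_iff) (simp_all add: scaleR_conv_of_real mult_ac)
qed

text \<open>Subtracting \<open>H w\<close> removes the pole, so \<open>A\<close> is entire and no
  distinction on the position of \<open>w\<close> relative to the real line is needed. The integral
  over [-R, R] is minus the one over the upper half circle. There H z / (z - w) is of order R^-2,
  and the subtracted constant behaves like - H w / z, which contributes - i \<pi> H w.\<close>

lemma half_plane_difference_quotient_limit:
  assumes hol: "H holomorphic_on UNIV"
    and bound: "\<And>z. Im z \<ge> 0 \<Longrightarrow> norm (H z) * norm (z - w) \<le> C"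
  defines "A \<equiv> \<lambda>z. if z = w then deriv H w else (H z - H w) / (z - w)"
  shows "((\<lambda>R. integral {-R..R} (\<lambda>x. A (of_real x))) \<longlongrightarrow> \<i> * pi * H w) at_top"
proof -
  have "A holomorphic_on UNIV" unfolding A_def by (rule holomorphic_difference_quotient[OF hol])
  then obtain Q where Q: "\<And>z. (Q has_field_derivative A z) (at z)"
    using entire_primitive by metis
  \<comment> \<open>For |z| = R > 2 |w| one has |z - w| \<ge> R / 2. The terms C / |z - w|^2 and |H
    w| |w| / (R |z - w|) are then at most 4 C / R^2 and 2 |H w| |w| / R^2.\<close>
  define K where "K = 4 * C + 2 * norm (H w) * norm w"
  have C: "C \<ge> 0" using bound[of 0] by (auto intro: order_trans[rotated])
  have est: "norm (integral {-R..R} (\<lambda>x. A (of_real x)) - \<i> * pi * H w) \<le> K * pi / R"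
    if R: "R > 2 * norm w" "R > 0" for R
  proof -
    have I: "integral {-R..R} (\<lambda>x. A (of_real x)) = Q (of_real R) - Q (- of_real R)"
      using primitive_has_integral_real[OF Q, of "-R" R] R by (simp add: integral_unique)
    have "(A has_contour_integral (Q (pathfinish (part_circlepath 0 R 0 pi))
            - Q (pathstart (part_circlepath 0 R 0 pi)))) (part_circlepath 0 R 0 pi)"
      by (rule contour_integral_primitive[of UNIV]) (use Q in auto)
    then have "(A has_contour_integral (Q (- of_real R) - Q (of_real R))) (part_circlepath 0 R 0 pi)"
      by (simp add: exp_Euler)
    from has_contour_integral_add[OF this has_contour_integral_inverse_half_circle[OF R(2), of "H w"]]
    have "((\<lambda>z. A z + H w / z) has_contour_integral (Q (- of_real R) - Q (of_real R) + \<i> * pi * H w))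
       (part_circlepath 0 R 0 pi)" .
    then have "norm (Q (- of_real R) - Q (of_real R) + \<i> * pi * H w) \<le> K / R\<^sup>2 * R * (pi - 0)"
    proof (rule has_contour_integral_bound_part_circlepath)
      show "0 \<le> K / R\<^sup>2" using C by (simp add: K_def)
      fix z assume "z \<in> path_image (part_circlepath 0 R 0 pi)"
      then obtain t where t: "0 \<le> t" "t \<le> pi" "z = R * cis t"
        by (auto simp: path_image_part_circlepath cis_conv_exp)
      have nz: "norm z = R" using t R by (simp add: norm_mult)
      have "Im z \<ge> 0" using t R by (simp add: sin_ge_zero)
      from bound[OF this] have b: "norm (H z) * norm (z - w) \<le> C" .
      have nzw: "norm (z - w) \<ge> R / 2"
        using norm_triangle_ineq2[of z w] nz R by linarith
      then have pos: "norm (z - w) > 0" using R by linarith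
      then have ne: "z \<noteq> w" "z \<noteq> 0" "z - w \<noteq> 0" using nz R by auto
      \<comment> \<open>Partial fractions: adding \<open>H w / z\<close> cancels the part of
        \<open>A\<close> of order 1/R, leaving terms of order R^-2 against an arc of length \<pi>
        R.\<close>
      have "w / (z * (z - w)) = 1 / (z - w) - 1 / z"
        using ne by (subst diff_frac_eq) (auto simp: mult.commute)
      then have "H w * w / (z * (z - w)) = H w / (z - w) - H w / z"
        by (metis (no_types) mult.right_neutral right_diff_distrib times_divide_eq_right)
      then have "A z + H w / z = H z / (z - w) - H w * w / (z * (z - w))"
        using ne by (simp add: A_def diff_divide_distrib)
      also have "H z / (z - w) = H z * (z - w) / (z - w)\<^sup>2"
        using ne by (simp add: power2_eq_square)
      finally have "norm (A z + H w / z) \<le> norm (H z) * norm (z - w) / (norm (z - w))\<^sup>2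
          + norm (H w) * norm w / (R * norm (z - w))"
        using norm_triangle_ineq4[of "H z * (z - w) / (z - w)\<^sup>2" "H w * w / (z * (z - w))"]
        by (simp add: norm_mult norm_divide norm_power nz)
      also have "\<dots> \<le> C / (R / 2)\<^sup>2 + norm (H w) * norm w / (R * (R / 2))"
      proof (intro add_mono frac_le)
        show "(R / 2)\<^sup>2 \<le> (norm (z - w))\<^sup>2" using nzw R by (intro power_mono) auto
        show "R * (R / 2) \<le> R * norm (z - w)" using nzw R by (intro mult_left_mono) auto
      qed (use b C R in auto)
      also have "\<dots> = K / R\<^sup>2" using R by (simp add: K_def field_simps power2_eq_square)
      finally show "norm (A z + H w / z) \<le> K / R\<^sup>2" .
    qed (use R in auto)
    also have "\<dots> = K * pi / R" using R by (simp add: power2_eq_square)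
    finally show ?thesis unfolding I
      by (metis (no_types, opaque_lifting) add.commute diff_diff_eq2 norm_minus_commute diff_add_eq)
  qed
  have "((\<lambda>R. integral {-R..R} (\<lambda>x. A (of_real x)) - \<i> * pi * H w) \<longlongrightarrow> 0) at_top"
  proof (rule Lim_null_comparison)
    show "eventually (\<lambda>R. norm (integral {-R..R} (\<lambda>x. A (of_real x)) - \<i> * pi * H w) \<le> K * pi / R) at_top"
      using eventually_gt_at_top[of "2 * norm w"] eventually_gt_at_top[of 0]
      by eventually_elim (rule est)
    show "((\<lambda>R. K * pi / R) \<longlongrightarrow> 0) at_top" by real_asymp
  qed
  then show ?thesis by (simp add: LIM_zero_iff)
qed

lemma tendsto_integral_symmetric:
  fixes f :: "real \<Rightarrow> complex"
  assumes "integrable lborel f"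
  shows "(\<lambda>n. integral {- real n..real n} f) \<longlonglongrightarrow> (LINT x|lborel. f x)"
proof -
  have "(\<lambda>n. LINT x|lborel. indicator {- real n..real n} x *\<^sub>R f x) \<longlonglongrightarrow> (LINT x|lborel. f x)"
  proof (rule integral_dominated_convergence)
    show "integrable lborel (\<lambda>x. norm (f x))" using assms by simp
    show "AE x in lborel. (\<lambda>n. indicator {- real n..real n} x *\<^sub>R f x) \<longlonglongrightarrow> f x"
    proof (rule AE_I2, rule tendsto_eventually)
      fix x :: real
      have "eventually (\<lambda>n. real n \<ge> \<bar>x\<bar>) sequentially" by real_asymp
      then show "eventually (\<lambda>n. indicator {- real n..real n} x *\<^sub>R f x = f x) sequentially"
        by eventually_elim (auto simp: indicator_def)
    qed
  qed (use assms in \<open>auto simp: indicator_def\<close>)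
  moreover have "(LINT x|lborel. indicator {- real n..real n} x *\<^sub>R f x) = integral {- real n..real n} f" for n
    using set_borel_integral_eq_integral(2)[OF set_integrable_subset[of lborel UNIV f "{- real n..real n}"]] assms
    by (simp add: set_lebesgue_integral_def set_integrable_def)
  ultimately show ?thesis by simp
qed

text \<open>\<open>H1\<close> carries the exponential of the sine that is controlled in the upper
  half plane. \<open>H2\<close> carries the other one, reflected by z \<mapsto> - z so that the same
  half plane lemma serves it. Both exponentials are normalized to 1 at the base point, so the
  subtracted constants are both \<open>G w\<close> and cancel in A1 x + A2 (- x). Each half
  contributes i \<pi> G w.\<close>

lemma reproducing_formula_decaying:
  assumes hol: "G holomorphic_on UNIV"
    and bound: "\<And>z. norm (G z) * norm (z - w) \<le> C * exp (pi * D * \<bar>Im z\<bar>)"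
    and int: "integrable lborel (\<lambda>x. G (complex_of_real x) * sincD D (of_real x - w))"
  shows "(LINT x|lborel. G (complex_of_real x) * sincD D (of_real x - w)) = G w"
proof -
  define H1 where "H1 = (\<lambda>z. G z * exp (\<i> * of_real (pi * D) * (z - w)))"
  define H2 where "H2 = (\<lambda>z. G (- z) * exp (\<i> * of_real (pi * D) * (z - (- w))))"
  define A1 where "A1 = (\<lambda>z. if z = w then deriv H1 w else (H1 z - H1 w) / (z - w))"
  define A2 where "A2 = (\<lambda>z. if z = - w then deriv H2 (- w) else (H2 z - H2 (- w)) / (z - (- w)))"
  have hol1: "H1 holomorphic_on UNIV" unfolding H1_def by (intro holomorphic_intros hol)
  have "(\<lambda>z. G (- z)) holomorphic_on UNIV"
    using holomorphic_on_compose_gen[of "\<lambda>z. - z" UNIV G UNIV] hol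
    by (simp add: o_def holomorphic_on_minus)
  then have hol2: "H2 holomorphic_on UNIV" unfolding H2_def by (intro holomorphic_intros)
  have lim1: "((\<lambda>R. integral {-R..R} (\<lambda>x. A1 (of_real x))) \<longlongrightarrow> \<i> * pi * H1 w) at_top"
    unfolding A1_def
  proof (rule half_plane_difference_quotient_limit[OF hol1])
    fix z :: complex assume "Im z \<ge> 0"
    have "norm (H1 z) * norm (z - w) = (norm (G z) * norm (z - w)) * exp (- pi * D * (Im z - Im w))"
      by (simp add: H1_def norm_mult algebra_simps)
    also have "\<dots> \<le> (C * exp (pi * D * \<bar>Im z\<bar>)) * exp (- pi * D * (Im z - Im w))"
      by (intro mult_right_mono bound) auto
    also have "\<dots> = C * exp (pi * D * Im w)"
      using \<open>Im z \<ge> 0\<close> by (simp add: exp_add[symmetric] algebra_simps)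
    finally show "norm (H1 z) * norm (z - w) \<le> C * exp (pi * D * Im w)" .
  qed
  have lim2: "((\<lambda>R. integral {-R..R} (\<lambda>x. A2 (of_real x))) \<longlongrightarrow> \<i> * pi * H2 (- w)) at_top"
    unfolding A2_def
  proof (rule half_plane_difference_quotient_limit[OF hol2])
    fix z :: complex assume "Im z \<ge> 0"
    have "norm (H2 z) * norm (z - (- w))
        = (norm (G (- z)) * norm (- z - w)) * exp (- pi * D * (Im z + Im w))"
    proof -
      have "norm (- z - w) = norm (z + w)"
        by (metis minus_add_distrib norm_minus_cancel uminus_add_conv_diff add.commute)
      then show ?thesis by (simp add: H2_def norm_mult algebra_simps)
    qed
    also have "\<dots> \<le> (C * exp (pi * D * \<bar>Im (- z)\<bar>)) * exp (- pi * D * (Im z + Im w))"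
      by (intro mult_right_mono bound) auto
    also have "\<dots> = C * exp (- pi * D * Im w)"
      using \<open>Im z \<ge> 0\<close> by (simp add: exp_add[symmetric] algebra_simps)
    finally show "norm (H2 z) * norm (z - (- w)) \<le> C * exp (- pi * D * Im w)" .
  qed
  let ?f = "\<lambda>x. G (complex_of_real x) * sincD D (of_real x - w)"
  have eq: "integral {-R..R} ?f = (integral {-R..R} (\<lambda>x. A1 (of_real x))
      + integral {-R..R} (\<lambda>x. A2 (of_real x))) / (2 * \<i> * pi)" for R
  proof -
    have i1: "(\<lambda>x. A1 (of_real x)) integrable_on {-R..R}"
      unfolding A1_def
      by (intro integrable_continuous_real continuous_on_subset[OF
            continuous_on_entire_real[OF holomorphic_difference_quotient[OF hol1]]]) auto
    have i2: "(\<lambda>x. A2 (of_real x)) integrable_on {-R..R}"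
      unfolding A2_def
      by (intro integrable_continuous_real continuous_on_subset[OF
            continuous_on_entire_real[OF holomorphic_difference_quotient[OF hol2]]]) auto
    have "(\<lambda>x. A2 (of_real (- x))) integrable_on {-R..R}"
      using i2 Henstock_Kurzweil_Integration.integrable_reflect_real[where f = "\<lambda>x. A2 (of_real x)" and a = "-R" and b = R] by simp
    have "integral {-R..R} ?f
        = integral {-R..R} (\<lambda>x. (A1 (of_real x) + A2 (of_real (- x))) / (2 * \<i> * pi))"
    \<comment> \<open>If \<open>w\<close> is real, \<open>A1\<close> and \<open>A2\<close> take
      their derivative values at x = w; this single point is discarded.\<close>
    proof (rule integral_spike[of "{Re w}"])
      fix x assume "x \<in> {-R..R} - {Re w}"
      then have ne: "complex_of_real x \<noteq> w" by auto
      define u where "u = complex_of_real x - w"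
      have u: "u \<noteq> 0" "- of_real x \<noteq> - w" using ne by (auto simp: u_def)
      have "A1 (of_real x) = (G x * exp (\<i> * of_real (pi * D) * u) - G w) / u"
        using ne by (simp add: A1_def H1_def u_def)
      moreover have "A2 (of_real (- x)) = (G x * exp (- (\<i> * of_real (pi * D) * u)) - G w) / (- u)"
        using ne by (simp add: A2_def H2_def u_def algebra_simps)
      ultimately have "A1 (of_real x) + A2 (of_real (- x))
         = G x * (exp (\<i> * of_real (pi * D) * u) - exp (- (\<i> * of_real (pi * D) * u))) / u"
        using u by (simp add: field_simps)
      also have "\<dots> = G x * (2 * \<i> * sin (of_real (pi * D) * u)) / u"
      proof -
        have "2 * \<i> * sin v = exp (\<i> * v) - exp (- (\<i> * v))" for v :: complex
          by (subst sin_exp_eq) simp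
        then show ?thesis by (simp only: mult.assoc)
      qed
      also have "\<dots> / (2 * \<i> * pi) = G x * sincD D u"
        using u by (simp add: sincD_def)
      finally show "(A1 (of_real x) + A2 (of_real (- x))) / (2 * \<i> * pi) = ?f x"
        by (simp add: u_def)
    qed auto
    also have "\<dots> = (integral {-R..R} (\<lambda>x. A1 (of_real x))
        + integral {-R..R} (\<lambda>x. A2 (of_real (- x)))) / (2 * \<i> * pi)"
      using i1 \<open>(\<lambda>x. A2 (of_real (- x))) integrable_on {-R..R}\<close>
      by (simp only: integral_divide integral_add)
    also have "integral {-R..R} (\<lambda>x. A2 (of_real (- x))) = integral {-R..R} (\<lambda>x. A2 (of_real x))"
      using Henstock_Kurzweil_Integration.integral_reflect_real[where f = "\<lambda>x. A2 (of_real x)" and a = "-R" and b = R] by simp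
    finally show ?thesis .
  qed
  have "((\<lambda>R. integral {-R..R} ?f) \<longlongrightarrow> (\<i> * pi * H1 w + \<i> * pi * H2 (- w)) / (2 * \<i> * pi)) at_top"
    unfolding eq by (intro tendsto_intros lim1 lim2) auto
  also have "(\<i> * pi * H1 w + \<i> * pi * H2 (- w)) / (2 * \<i> * pi) = G w"
    by (simp add: H1_def H2_def field_simps)
  finally have "(\<lambda>n. integral {- real n..real n} ?f) \<longlonglongrightarrow> G w"
    by (rule filterlim_compose[OF _ filterlim_real_sequentially])
  with tendsto_integral_symmetric[OF int] show ?thesis
    by (rule LIMSEQ_unique)
qed

section \<open>Integrability on the real line and products with the cardinal sine\<close>

lemma integrable_inverse_one_plus_norm_squared:
  "integrable lborel (\<lambda>x. (1 / (1 + norm (complex_of_real x - w)))\<^sup>2)"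
proof (rule Bochner_Integration.integrable_bound)
  have "integrable lborel (\<lambda>x::real. inverse (1 + x\<^sup>2))"
    using integrable_inverse_1_plus_square by (simp add: set_integrable_def)
  from lborel_integrable_real_affine[OF this, of 1 "- Re w"]
  show "integrable lborel (\<lambda>x. inverse (1 + (- Re w + 1 * x)\<^sup>2))" by simp
  show "AE x in lborel. norm ((1 / (1 + norm (complex_of_real x - w)))\<^sup>2) \<le> norm (inverse (1 + (- Re w + 1 * x)\<^sup>2))"
  proof (rule AE_I2)
    fix x :: real
    let ?n = "norm (complex_of_real x - w)"
    have "\<bar>x - Re w\<bar>\<^sup>2 \<le> ?n\<^sup>2"
      using abs_Re_le_cmod[of "complex_of_real x - w"] by (intro power_mono) auto
    moreover have "(1 + ?n)\<^sup>2 = 1 + 2 * ?n + ?n\<^sup>2" "(- Re w + 1 * x)\<^sup>2 = \<bar>x - Re w\<bar>\<^sup>2"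
      by (simp_all add: power2_eq_square algebra_simps)
    ultimately have "1 + (- Re w + 1 * x)\<^sup>2 \<le> (1 + ?n)\<^sup>2"
      using norm_ge_zero[of "complex_of_real x - w"] by linarith
    moreover have "1 + (- Re w + 1 * x)\<^sup>2 > 0" by (intro add_pos_nonneg) auto
    ultimately show "norm ((1 / (1 + ?n))\<^sup>2) \<le> norm (inverse (1 + (- Re w + 1 * x)\<^sup>2))"
      by (simp add: power_divide divide_inverse power_inverse le_imp_inverse_le)
  qed
qed auto

text \<open>The pointwise inequality a b \<le> a^2 + b^2 does the work of Cauchy-Schwarz. The
  function obtained here is also the majorant in the final limit.\<close>

lemma integrable_square_times_decay:
  assumes hol: "F holomorphic_on UNIV"
    and L2: "integrable lborel (\<lambda>x. (norm (F (complex_of_real x)))\<^sup>2)"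
  shows "integrable lborel (\<lambda>x. norm (F (complex_of_real x)) / (1 + norm (complex_of_real x - w)))"
proof (rule Bochner_Integration.integrable_bound)
  show "integrable lborel (\<lambda>x. (norm (F (complex_of_real x)))\<^sup>2 + (1 / (1 + norm (complex_of_real x - w)))\<^sup>2)"
    using L2 integrable_inverse_one_plus_norm_squared by (rule Bochner_Integration.integrable_add)
  have [measurable]: "(\<lambda>x. F (complex_of_real x)) \<in> borel_measurable borel"
    using borel_measurable_entire_real[OF hol] by simp
  show "(\<lambda>x. norm (F (complex_of_real x)) / (1 + norm (complex_of_real x - w))) \<in> borel_measurable lborel"
    by measurable
  have "a * b \<le> a\<^sup>2 + b\<^sup>2" if "a \<ge> 0" "b \<ge> 0" for a b :: real
    using sum_squares_bound[of a b] mult_nonneg_nonneg[OF that] by linarith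
  from this[of "norm (F _)" "1 / (1 + norm _)"]
  show "AE x in lborel. norm (norm (F (complex_of_real x)) / (1 + norm (complex_of_real x - w)))
      \<le> norm ((norm (F (complex_of_real x)))\<^sup>2 + (1 / (1 + norm (complex_of_real x - w)))\<^sup>2)"
    by (intro AE_I2) simp
qed

lemma integrable_times_sincD:
  assumes hol: "F holomorphic_on UNIV"
    and L2: "integrable lborel (\<lambda>x. (norm (F (complex_of_real x)))\<^sup>2)" and D: "D \<ge> 0"
  shows "integrable lborel (\<lambda>x. F (complex_of_real x) * sincD D (of_real x - w))"
proof (rule Bochner_Integration.integrable_bound)
  let ?K = "(D + 1) * exp (pi * D * \<bar>Im w\<bar>)"
  show "integrable lborel (\<lambda>x. ?K * (norm (F (complex_of_real x)) / (1 + norm (complex_of_real x - w))))"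
    by (intro integrable_mult_right integrable_square_times_decay hol L2)
  show "(\<lambda>x. F (complex_of_real x) * sincD D (of_real x - w)) \<in> borel_measurable lborel"
    by (rule borel_measurable_entire_real[where f = "\<lambda>z. F z * sincD D (z - w)"])
       (intro holomorphic_intros hol)
  show "AE x in lborel. norm (F (complex_of_real x) * sincD D (of_real x - w))
     \<le> norm (?K * (norm (F (complex_of_real x)) / (1 + norm (complex_of_real x - w))))"
  proof (rule AE_I2)
    fix x :: real
    have "norm (F (of_real x)) * norm (sincD D (of_real x - w))
        \<le> norm (F (of_real x)) * (?K / (1 + norm (complex_of_real x - w)))"
      using norm_sincD_decay[OF D, of "of_real x - w"] by (intro mult_left_mono) auto
    then show "norm (F (complex_of_real x) * sincD D (of_real x - w))
     \<le> norm (?K * (norm (F (complex_of_real x)) / (1 + norm (complex_of_real x - w))))"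
      using D by (simp add: norm_mult mult_ac)
  qed
qed

lemma exp_type_le_times_sincD:
  assumes "exp_type_le \<tau> F" "D \<ge> 0"
  shows "exp_type_le (\<tau> + pi * D) (\<lambda>z. F z * sincD D (z - w))"
  unfolding exp_type_le_def
proof (intro allI impI)
  fix e :: real assume "e > 0"
  then obtain C where C: "\<And>z. norm (F z) \<le> C * exp ((\<tau> + e) * norm z)"
    using assms(1) unfolding exp_type_le_def by blast
  have C0: "C \<ge> 0" using order_trans[OF norm_ge_zero C[of 0]] by simp
  have "norm (F z * sincD D (z - w)) \<le> C * D * exp (pi * D * \<bar>Im w\<bar>) * exp ((\<tau> + pi * D + e) * norm z)" for z
  proof -
    have "\<bar>Im (z - w)\<bar> \<le> norm z + \<bar>Im w\<bar>" using abs_Im_le_cmod[of z] by simp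
    then have "pi * D * \<bar>Im (z - w)\<bar> \<le> pi * D * (norm z + \<bar>Im w\<bar>)"
      using assms by (intro mult_left_mono) auto
    then have "D * exp (pi * D * \<bar>Im (z - w)\<bar>) \<le> D * exp (pi * D * (norm z + \<bar>Im w\<bar>))"
      using assms by (intro mult_left_mono) auto
    then have "norm (sincD D (z - w)) \<le> D * exp (pi * D * (norm z + \<bar>Im w\<bar>))"
      using norm_sincD_le[OF assms(2), of "z - w"] by linarith
    then have "norm (F z * sincD D (z - w))
       \<le> (C * exp ((\<tau> + e) * norm z)) * (D * exp (pi * D * (norm z + \<bar>Im w\<bar>)))"
      unfolding norm_mult using C C0 by (intro mult_mono) auto
    also have "\<dots> = C * D * exp (pi * D * \<bar>Im w\<bar>) * exp ((\<tau> + pi * D + e) * norm z)"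
      by (simp add: exp_add algebra_simps)
    finally show ?thesis .
  qed
  then show "\<exists>C. \<forall>z. norm (F z * sincD D (z - w)) \<le> C * exp ((\<tau> + pi * D + e) * norm z)"
    by blast
qed

lemma integrable_square_times_bounded:
  assumes hol: "F holomorphic_on UNIV" "g holomorphic_on UNIV"
    and L2: "integrable lborel (\<lambda>x. (norm (F (complex_of_real x)))\<^sup>2)"
    and bd: "\<And>x. norm (g (complex_of_real x)) \<le> B"
  shows "integrable lborel (\<lambda>x. (norm (F (complex_of_real x) * g (of_real x)))\<^sup>2)"
proof (rule Bochner_Integration.integrable_bound)
  show "integrable lborel (\<lambda>x. B\<^sup>2 * (norm (F (complex_of_real x)))\<^sup>2)"
    by (intro integrable_mult_right L2)
  have [measurable]: "(\<lambda>x. F (complex_of_real x)) \<in> borel_measurable borel"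
     "(\<lambda>x. g (complex_of_real x)) \<in> borel_measurable borel"
    using hol[THEN borel_measurable_entire_real] by simp_all
  show "(\<lambda>x. (norm (F (complex_of_real x) * g (of_real x)))\<^sup>2) \<in> borel_measurable lborel"
    by measurable
  have "(norm (g (complex_of_real x)))\<^sup>2 * (norm (F (complex_of_real x)))\<^sup>2
     \<le> B\<^sup>2 * (norm (F (complex_of_real x)))\<^sup>2" for x
    using bd by (intro mult_right_mono power_mono) auto
  then show "AE x in lborel. norm ((norm (F (complex_of_real x) * g (of_real x)))\<^sup>2)
     \<le> norm (B\<^sup>2 * (norm (F (complex_of_real x)))\<^sup>2)"
    by (intro AE_I2) (simp add: norm_mult power_mult_distrib mult_ac)
qed

text \<open>The 3 in \<open>D + 3 * \<eta>\<close> is a budget: one \<open>\<eta>\<close> for the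
  factor that makes \<open>F\<close> integrable, one because
  \<open>exp_type_integrable_bound\<close> needs a strictly larger type, one for the factor that
  supplies the decay in |z - w|. Division by \<open>\<eta>\<close> makes the squared factor equal to
  1 at \<open>w\<close>, so that \<open>G w = F w\<close>.\<close>

lemma reproducing_formula_regularized:
  assumes F: "F \<in> HO D" and D: "D > 0" and eta: "\<eta> > 0"
  shows "(LINT x|lborel. F (complex_of_real x) * (sincD \<eta> (of_real x - w) / \<eta>)\<^sup>2
            * sincD (D + 3 * \<eta>) (of_real x - w)) = F w"
proof -
  have hol: "F holomorphic_on UNIV" and type: "exp_type_le (pi * D) F"
    and L2: "integrable lborel (\<lambda>x::real. (norm (F (complex_of_real x)))\<^sup>2)"
    using F by (auto simp: HO_def)
  define s where "s = (\<lambda>z. sincD \<eta> (z - w))"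
  have hols: "s holomorphic_on UNIV" unfolding s_def by (intro holomorphic_intros)
  have "(\<lambda>z. F z * s z) holomorphic_on UNIV" by (intro holomorphic_intros hol hols)
  moreover have "exp_type_le (pi * D + pi * \<eta>) (\<lambda>z. F z * s z)" unfolding s_def
    using exp_type_le_times_sincD[OF type] eta by simp
  moreover have "integrable lborel (\<lambda>x. F (complex_of_real x) * s (of_real x))"
    unfolding s_def using integrable_times_sincD[OF hol L2] eta by simp
  ultimately obtain M where M: "M > 0"
      "\<And>z. norm (F z * s z) \<le> M * exp ((pi * D + pi * \<eta> + pi * \<eta>) * \<bar>Im z\<bar>)"
    using exp_type_integrable_bound[of "\<lambda>z. F z * s z" "pi * D + pi * \<eta>" "pi * D + pi * \<eta> + pi * \<eta>"] D eta
    by auto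
  define G where "G = (\<lambda>z. F z * (s z / \<eta>)\<^sup>2)"
  have holG: "G holomorphic_on UNIV" unfolding G_def using eta by (intro holomorphic_intros hol hols) auto
  have bound: "norm (G z) * norm (z - w)
      \<le> M * exp (pi * \<eta> * \<bar>Im w\<bar>) / \<eta>\<^sup>2 * exp (pi * (D + 3 * \<eta>) * \<bar>Im z\<bar>)" for z
  proof -
    have "norm (z - w) * norm (s z) \<le> exp (pi * \<eta> * \<bar>Im (z - w)\<bar>)"
      unfolding s_def using norm_mult_sincD_le[of \<eta> "z - w"] eta by simp
    also have "\<dots> \<le> exp (pi * \<eta> * (\<bar>Im z\<bar> + \<bar>Im w\<bar>))"
      using eta by (auto intro!: mult_left_mono)
    finally have *: "norm (z - w) * norm (s z) \<le> exp (pi * \<eta> * (\<bar>Im z\<bar> + \<bar>Im w\<bar>))" .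
    have "norm (G z) * norm (z - w) = norm (F z * s z) * (norm (z - w) * norm (s z)) / \<eta>\<^sup>2"
      using eta by (simp add: G_def norm_mult norm_divide norm_power power2_eq_square mult_ac)
    also have "\<dots> \<le> (M * exp ((pi * D + pi * \<eta> + pi * \<eta>) * \<bar>Im z\<bar>))
         * exp (pi * \<eta> * (\<bar>Im z\<bar> + \<bar>Im w\<bar>)) / \<eta>\<^sup>2"
      using M(1) by (intro divide_right_mono mult_mono M(2) *) auto
    also have "\<dots> = M * exp (pi * \<eta> * \<bar>Im w\<bar>) / \<eta>\<^sup>2 * exp (pi * (D + 3 * \<eta>) * \<bar>Im z\<bar>)"
      by (simp add: exp_add[symmetric] algebra_simps)
    finally show ?thesis .
  qed
  \<comment> \<open>The regularizing factor is bounded on the real axis, so \<open>G\<close> stays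
    square integrable and its product with the kernel is integrable.\<close>
  have "norm (s (complex_of_real x) / \<eta>) \<le> exp (pi * \<eta> * \<bar>Im w\<bar>)" for x
    using norm_sincD_le[of \<eta> "of_real x - w"] eta by (simp add: s_def norm_divide field_simps)
  then have sbd: "norm ((s (complex_of_real x) / \<eta>)\<^sup>2) \<le> (exp (pi * \<eta> * \<bar>Im w\<bar>))\<^sup>2" for x
    unfolding norm_power by (intro power_mono) auto
  have "integrable lborel (\<lambda>x. (norm (F (complex_of_real x) * (s (of_real x) / \<eta>)\<^sup>2))\<^sup>2)"
    by (rule integrable_square_times_bounded[where g = "\<lambda>z. (s z / \<eta>)\<^sup>2", OF hol _ L2 sbd])
       (use eta in \<open>intro holomorphic_intros hols; auto\<close>)
  then have "integrable lborel (\<lambda>x. (norm (G (complex_of_real x)))\<^sup>2)"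
    by (simp add: G_def)
  from integrable_times_sincD[OF holG this, of "D + 3 * \<eta>" w]
  have "integrable lborel (\<lambda>x. G (complex_of_real x) * sincD (D + 3 * \<eta>) (of_real x - w))"
    using D eta by simp
  from reproducing_formula_decaying[OF holG bound this]
  have "(LINT x|lborel. G (complex_of_real x) * sincD (D + 3 * \<eta>) (of_real x - w)) = G w" .
  then show ?thesis using eta by (simp add: G_def s_def sincD_def)
qed

section \<open>Removal of the regularization\<close>

lemma tendsto_sincD_normalized:
  assumes "\<eta> \<longlonglongrightarrow> 0" "\<And>n. \<eta> n > 0"
  shows "(\<lambda>n. sincD (\<eta> n) u / \<eta> n) \<longlonglongrightarrow> 1"
proof (cases "u = 0")
  case True
  then show ?thesis using assms(2) by (simp add: sincD_def less_imp_neq[THEN not_sym])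
next
  case False
  define h where "h = (\<lambda>n. complex_of_real (pi * \<eta> n) * u)"
  have "h \<longlonglongrightarrow> complex_of_real (pi * 0) * u"
    unfolding h_def by (intro tendsto_intros assms)
  moreover have h0: "h n \<noteq> 0" for n
    using False assms(2)[of n] by (simp add: h_def)
  ultimately have "filterlim h (at 0) sequentially"
    by (intro filterlim_atI) auto
  moreover have "((\<lambda>z::complex. sin z / z) \<longlongrightarrow> 1) (at 0)"
    using DERIV_sin[of "0::complex"] by (simp add: DERIV_def)
  ultimately have "(\<lambda>n. sin (h n) / h n) \<longlonglongrightarrow> 1"
    using filterlim_compose by blast
  moreover have "sin (h n) / h n = sincD (\<eta> n) u / \<eta> n" for n
    using False by (simp add: h_def sincD_def mult_ac)
  ultimately show ?thesis by simp
qed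

lemma tendsto_sincD_type:
  assumes "f \<longlonglongrightarrow> D"
  shows "(\<lambda>n. sincD (f n) u) \<longlonglongrightarrow> sincD D u"
proof (cases "u = 0")
  case True
  then show ?thesis using assms by (simp add: sincD_def tendsto_of_real)
next
  case False
  then show ?thesis unfolding sincD_def by (auto intro!: tendsto_intros assms)
qed

theorem paley_wiener_reproducing_formula:
  assumes F: "F \<in> HO D" and D: "D > 0"
  shows "(LINT x|lborel. F (complex_of_real x) * sincD D (of_real x - w)) = F w"
proof -
  have hol: "F holomorphic_on UNIV"
    and L2: "integrable lborel (\<lambda>x::real. (norm (F (complex_of_real x)))\<^sup>2)"
    using F by (auto simp: HO_def)
  define \<eta> where "\<eta> = (\<lambda>n. 1 / real (Suc n))"
  have eta0: "\<eta> n > 0" and eta1: "\<eta> n \<le> 1" for n by (simp_all add: \<eta>_def)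
  have lim: "\<eta> \<longlonglongrightarrow> 0" unfolding \<eta>_def by real_asymp
  define f where "f = (\<lambda>n x. F (complex_of_real x) * (sincD (\<eta> n) (of_real x - w) / \<eta> n)\<^sup>2
            * sincD (D + 3 * \<eta> n) (of_real x - w))"
  \<comment> \<open>Uniform in \<open>n\<close>: for real \<open>x\<close> the exponents involve
    only |Im w|, and \<open>\<eta> n \<le> 1\<close> bounds the squared factor by exp (\<pi> |Im
    w|)^2 and D + 3 \<eta> + 1 by D + 4.\<close>
  define K where "K = (exp (pi * \<bar>Im w\<bar>))\<^sup>2 * ((D + 4) * exp (pi * (D + 3) * \<bar>Im w\<bar>))"
  have "(\<lambda>n. LINT x|lborel. f n x) \<longlonglongrightarrow> (LINT x|lborel. F (complex_of_real x) * sincD D (of_real x - w))"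
  proof (rule integral_dominated_convergence)
    show "(\<lambda>x. F (complex_of_real x) * sincD D (of_real x - w)) \<in> borel_measurable lborel"
      by (rule borel_measurable_entire_real[where f = "\<lambda>z. F z * sincD D (z - w)"])
         (intro holomorphic_intros hol)
    show "f n \<in> borel_measurable lborel" for n
      unfolding f_def
      by (rule borel_measurable_entire_real[where
            f = "\<lambda>z. F z * (sincD (\<eta> n) (z - w) / \<eta> n)\<^sup>2 * sincD (D + 3 * \<eta> n) (z - w)"])
         (use eta0[of n] in \<open>intro holomorphic_intros hol; auto\<close>)
    show "integrable lborel (\<lambda>x. K * (norm (F (complex_of_real x)) / (1 + norm (complex_of_real x - w))))"
      by (intro integrable_mult_right integrable_square_times_decay hol L2)
    show "AE x in lborel. (\<lambda>n. f n x) \<longlonglongrightarrow> F (complex_of_real x) * sincD D (of_real x - w)"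
    proof (rule AE_I2)
      fix x
      have "(\<lambda>n. D + 3 * \<eta> n) \<longlonglongrightarrow> D + 3 * 0" by (intro tendsto_intros lim)
      then have "(\<lambda>n. f n x) \<longlonglongrightarrow> F (complex_of_real x) * 1\<^sup>2 * sincD D (of_real x - w)"
        unfolding f_def by (intro tendsto_intros tendsto_sincD_normalized tendsto_sincD_type lim eta0) simp
      then show "(\<lambda>n. f n x) \<longlonglongrightarrow> F (complex_of_real x) * sincD D (of_real x - w)" by simp
    qed
    show "AE x in lborel. norm (f n x) \<le> K * (norm (F (complex_of_real x)) / (1 + norm (complex_of_real x - w)))" for n
    proof (rule AE_I2)
      fix x
      let ?u = "complex_of_real x - w"
      have "norm (sincD (\<eta> n) ?u) \<le> \<eta> n * exp (pi * \<eta> n * \<bar>Im w\<bar>)"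
        using norm_sincD_le[of "\<eta> n" ?u] eta0[of n] by simp
      also have "\<dots> \<le> \<eta> n * exp (pi * 1 * \<bar>Im w\<bar>)"
        using eta0[of n] eta1[of n] by (intro mult_left_mono) (auto intro!: mult_left_le_one_le)
      finally have "norm (sincD (\<eta> n) ?u / \<eta> n) \<le> exp (pi * \<bar>Im w\<bar>)"
        using eta0[of n] by (simp add: norm_divide field_simps)
      then have 1: "norm ((sincD (\<eta> n) ?u / \<eta> n)\<^sup>2) \<le> (exp (pi * \<bar>Im w\<bar>))\<^sup>2"
        unfolding norm_power by (intro power_mono) auto
      have "norm (sincD (D + 3 * \<eta> n) ?u)
          \<le> (D + 3 * \<eta> n + 1) * exp (pi * (D + 3 * \<eta> n) * \<bar>Im w\<bar>) / (1 + norm ?u)"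
        using norm_sincD_decay[of "D + 3 * \<eta> n" ?u] eta0[of n] D by simp
      also have "\<dots> \<le> (D + 4) * exp (pi * (D + 3) * \<bar>Im w\<bar>) / (1 + norm ?u)"
        using eta0[of n] eta1[of n] D
        by (intro divide_right_mono mult_mono) (auto intro!: mult_right_mono)
      finally have 2: "norm (sincD (D + 3 * \<eta> n) ?u)
          \<le> (D + 4) * exp (pi * (D + 3) * \<bar>Im w\<bar>) / (1 + norm ?u)" .
      have "norm (f n x) \<le> norm (F x) * (exp (pi * \<bar>Im w\<bar>))\<^sup>2
          * ((D + 4) * exp (pi * (D + 3) * \<bar>Im w\<bar>) / (1 + norm ?u))"
        unfolding f_def norm_mult using 1 2 by (intro mult_mono) (auto simp: norm_mult)
      then show "norm (f n x) \<le> K * (norm (F (complex_of_real x)) / (1 + norm ?u))"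
        by (simp add: K_def mult_ac)
    qed
  qed
  moreover have "(LINT x|lborel. f n x) = F w" for n
    unfolding f_def by (rule reproducing_formula_regularized[OF F D eta0])
  ultimately show ?thesis by (simp add: LIMSEQ_const_iff)
qed

subsection \<open>The kernel of the space with point mass\<close>

lemma HO_scale:
  assumes "F \<in> HO D"
  shows "(\<lambda>z. c * F z) \<in> HO D"
proof -
  have "exp_type_le (pi * D) (\<lambda>z. c * F z)"
    unfolding exp_type_le_def
  proof (intro allI impI)
    fix e :: real assume "e > 0"
    then obtain C where C: "\<And>z. norm (F z) \<le> C * exp ((pi * D + e) * norm z)"
      using assms unfolding HO_def exp_type_le_def by blast
    have "norm (c * F z) \<le> norm c * C * exp ((pi * D + e) * norm z)" for z
      using mult_left_mono[OF C[of z], of "norm c"] by (simp add: norm_mult mult.assoc)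
    then show "\<exists>C. \<forall>z. norm (c * F z) \<le> C * exp ((pi * D + e) * norm z)" by blast
  qed
  then show ?thesis using assms
    by (auto simp: HO_def norm_mult power_mult_distrib intro!: holomorphic_intros)
qed

lemma HO_diff:
  assumes F: "F \<in> HO D" and G: "G \<in> HO D"
  shows "(\<lambda>z. F z - G z) \<in> HO D"
proof -
  have hol: "F holomorphic_on UNIV" "G holomorphic_on UNIV" using F G by (auto simp: HO_def)
  have "exp_type_le (pi * D) (\<lambda>z. F z - G z)"
    unfolding exp_type_le_def
  proof (intro allI impI)
    fix e :: real assume e: "e > 0"
    obtain C where C: "\<And>z. norm (F z) \<le> C * exp ((pi * D + e) * norm z)"
      using F e unfolding HO_def exp_type_le_def by blast
    obtain C' where C': "\<And>z. norm (G z) \<le> C' * exp ((pi * D + e) * norm z)"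
      using G e unfolding HO_def exp_type_le_def by blast
    have "norm (F z - G z) \<le> (C + C') * exp ((pi * D + e) * norm z)" for z
      using norm_triangle_ineq4[of "F z" "G z"] C[of z] C'[of z] by (simp add: ring_distribs)
    then show "\<exists>C. \<forall>z. norm (F z - G z) \<le> C * exp ((pi * D + e) * norm z)" by blast
  qed
  moreover have "integrable lborel (\<lambda>x. (norm (F (complex_of_real x) - G (of_real x)))\<^sup>2)"
  proof (rule Bochner_Integration.integrable_bound)
    show "integrable lborel (\<lambda>x. 2 * (norm (F (complex_of_real x)))\<^sup>2 + 2 * (norm (G (complex_of_real x)))\<^sup>2)"
      using F G by (auto simp: HO_def)
    have [measurable]: "(\<lambda>x. F (complex_of_real x)) \<in> borel_measurable borel"
       "(\<lambda>x. G (complex_of_real x)) \<in> borel_measurable borel"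
      using hol[THEN borel_measurable_entire_real] by simp_all
    show "(\<lambda>x. (norm (F (complex_of_real x) - G (of_real x)))\<^sup>2) \<in> borel_measurable lborel"
      by measurable
    have "(norm (a - b))\<^sup>2 \<le> 2 * (norm a)\<^sup>2 + 2 * (norm b)\<^sup>2" for a b :: complex
    proof -
      have "(norm (a - b))\<^sup>2 \<le> (norm a + norm b)\<^sup>2"
        by (intro power_mono norm_triangle_ineq4) auto
      also have "\<dots> \<le> 2 * (norm a)\<^sup>2 + 2 * (norm b)\<^sup>2"
        using sum_squares_bound[of "norm a" "norm b"] by (simp add: power2_sum)
      finally show ?thesis .
    qed
    then show "AE x in lborel. norm ((norm (F (complex_of_real x) - G (of_real x)))\<^sup>2)
       \<le> norm (2 * (norm (F (complex_of_real x)))\<^sup>2 + 2 * (norm (G (complex_of_real x)))\<^sup>2)"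
      by (intro AE_I2) simp
  qed
  ultimately show ?thesis using hol by (auto simp: HO_def intro!: holomorphic_intros)
qed

lemma sincD_mem_HO:
  assumes "D > 0"
  shows "(\<lambda>z. sincD D (z - w)) \<in> HO D"
proof -
  \<comment> \<open>The constant 1 has type 0, so the rule for products yields the type of the
    kernel itself.\<close>
  have "exp_type_le 0 (\<lambda>z. 1)"
    unfolding exp_type_le_def by (auto intro!: exI[of _ 1])
  from exp_type_le_times_sincD[OF this, of D w]
  have "exp_type_le (pi * D) (\<lambda>z. sincD D (z - w))" using assms by simp
  moreover have hol: "(\<lambda>z. sincD D (z - w)) holomorphic_on UNIV" by (intro holomorphic_intros)
  moreover have "integrable lborel (\<lambda>x. (norm (sincD D (complex_of_real x - w)))\<^sup>2)"
  proof (rule Bochner_Integration.integrable_bound)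
    let ?K = "(D + 1) * exp (pi * D * \<bar>Im w\<bar>)"
    show "integrable lborel (\<lambda>x. ?K\<^sup>2 * (1 / (1 + norm (complex_of_real x - w)))\<^sup>2)"
      by (intro integrable_mult_right integrable_inverse_one_plus_norm_squared)
    have [measurable]: "(\<lambda>x. sincD D (complex_of_real x - w)) \<in> borel_measurable borel"
      using borel_measurable_entire_real[OF hol] by simp
    show "(\<lambda>x. (norm (sincD D (complex_of_real x - w)))\<^sup>2) \<in> borel_measurable lborel"
      by measurable
    have "(norm (sincD D (complex_of_real x - w)))\<^sup>2 \<le> (?K / (1 + norm (complex_of_real x - w)))\<^sup>2" for x
      using norm_sincD_decay[of D "of_real x - w"] assms by (intro power_mono) auto
    then show "AE x in lborel. norm ((norm (sincD D (complex_of_real x - w)))\<^sup>2)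
       \<le> norm (?K\<^sup>2 * (1 / (1 + norm (complex_of_real x - w)))\<^sup>2)"
      by (intro AE_I2) (simp add: power_divide)
  qed
  ultimately show ?thesis by (simp add: HO_def)
qed

section \<open>Uniqueness of the kernel and the rank-one correction\<close>

lemma cnj_sincD: "cnj (sincD D z) = sincD D (cnj z)"
  by (simp add: sincD_def cnj_sin)

lemma sincD_minus: "sincD D (- z) = sincD D z"
  by (simp add: sincD_def)

lemma HO_inner_cnj: "cnj (HO_inner F G) = HO_inner G F"
proof -
  have "cnj (LINT x|lborel. F (complex_of_real x) * cnj (G (of_real x)))
      = (LINT x|lborel. cnj (F (complex_of_real x) * cnj (G (of_real x))))"
    by (rule Bochner_Integration.integral_cnj[symmetric])
  then show ?thesis by (simp add: HO_inner_def mult_ac)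
qed

text \<open>Two kernels agree because each is the conjugate transpose of the other.\<close>

lemma reproducing_kernel_unique:
  assumes "\<And>w. K w \<in> HO D" "\<And>w F. F \<in> HO D \<Longrightarrow> F w = HO_inner F (K w)"
    and "\<And>w. L w \<in> HO D" "\<And>w F. F \<in> HO D \<Longrightarrow> F w = HO_inner F (L w)"
  shows "K = L"
proof (intro ext)
  fix w v
  have "K w v = cnj (HO_inner (L v) (K w))"
    using assms(4)[OF assms(1)] by (simp add: HO_inner_cnj)
  also have "\<dots> = cnj (HO_inner (L v) (L w))"
    using assms(2)[OF assms(3)] assms(4)[OF assms(3)] by simp
  also have "\<dots> = L w v"
    using assms(4)[OF assms(3)] by (simp add: HO_inner_cnj)
  finally show "K w v = L w v" .
qed

lemma KO_eqI:
  assumes "\<And>w. K w \<in> HO D" "\<And>w F. F \<in> HO D \<Longrightarrow> F w = HO_inner F (K w)"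
  shows "KO D = K"
  unfolding KO_def
proof (rule the_equality)
  show "(\<forall>w. K w \<in> HO D) \<and> (\<forall>w. \<forall>F\<in>HO D. F w = HO_inner F (K w))"
    using assms by blast
  show "L = K" if "(\<forall>w. L w \<in> HO D) \<and> (\<forall>w. \<forall>F\<in>HO D. F w = HO_inner F (L w))" for L
    using that by (intro reproducing_kernel_unique[OF _ _ assms]) auto
qed

theorem theorem4:
  fixes Delta :: real and w z :: complex
  assumes "Delta > 0"
  shows "KO Delta w z = sincD Delta (z - cnj w)
           - 1 / (2 + complex_of_real Delta) * sincD Delta z * sincD Delta (cnj w)"
proof -
  \<comment> \<open>With the Paley-Wiener kernel at \<open>cnj w\<close> corrected by
    \<open>c w\<close> times the one at 0, the pairing exceeds \<open>F w\<close> by F 0 (cnj (K w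
    0) / 2 - cnj (c w)). Since K w 0 = sincD Delta (cnj w) - c w Delta, this vanishes exactly when c
    w (2 + Delta) = sincD Delta (cnj w).\<close>
  define c where "c = (\<lambda>w. 1 / (2 + complex_of_real Delta) * sincD Delta (cnj w))"
  \<comment> \<open>Writing \<open>z - 0\<close> presents the correction as the kernel at the point
    0, so the facts about shifted kernels apply to both terms.\<close>
  define K where "K = (\<lambda>w z. sincD Delta (z - cnj w) - c w * sincD Delta (z - 0))"
  have ne: "2 + complex_of_real Delta \<noteq> 0"
    using assms by (simp add: complex_eq_iff)
  have "KO Delta = K"
  proof (rule KO_eqI)
    show "K w \<in> HO Delta" for w
      unfolding K_def by (intro HO_diff HO_scale sincD_mem_HO assms)
  next
    fix w F assume F: "F \<in> HO Delta"
    then have hol: "F holomorphic_on UNIV"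
      and L2: "integrable lborel (\<lambda>x::real. (norm (F (complex_of_real x)))\<^sup>2)"
      by (auto simp: HO_def)
    have cnjK: "cnj (K w (of_real x)) = sincD Delta (of_real x - w)
        - cnj (c w) * sincD Delta (of_real x - 0)" for x
      by (simp add: K_def cnj_sincD)
    have "(LINT x|lborel. F (complex_of_real x) * cnj (K w (of_real x)))
       = (LINT x|lborel. F (complex_of_real x) * sincD Delta (of_real x - w)
           - cnj (c w) * (F (of_real x) * sincD Delta (of_real x - 0)))"
      unfolding cnjK by (simp add: algebra_simps)
    also have "\<dots> = F w - cnj (c w) * F 0"
      using integrable_times_sincD[OF hol L2, of Delta w] integrable_times_sincD[OF hol L2, of Delta 0]
        paley_wiener_reproducing_formula[OF F assms, of w]
        paley_wiener_reproducing_formula[OF F assms, of 0] assms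
      by (subst Bochner_Integration.integral_diff) (auto intro!: integrable_mult_right)
    finally have "HO_inner F (K w) = F w + F 0 * (1/2 * cnj (K w 0) - cnj (c w))"
      by (simp add: HO_inner_def algebra_simps)
    also have "1/2 * cnj (K w 0) - cnj (c w) = 0"
    proof -
      have "cnj (K w 0) = sincD Delta w - cnj (c w) * Delta"
        using cnjK[of 0] sincD_minus[of Delta w] by (simp add: sincD_def[of _ 0])
      moreover have "cnj (c w) * (2 + Delta) = sincD Delta w"
        using ne by (simp add: c_def cnj_sincD)
      ultimately have "cnj (K w 0) = cnj (c w) * (2 + Delta) - cnj (c w) * Delta" by simp
      then show ?thesis by (simp add: algebra_simps)
    qed
    finally show "F w = HO_inner F (K w)" by simp
  qed
  then show ?thesis by (simp add: K_def c_def mult_ac)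
qed

end
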